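(* There exists a sequence of real numbers $c_k$, satisfying $c_k>1/9$ for each $k\ge 3$ and $c_k\to 1/\sqrt{6e}$ as $k\to\infty$, such that for all positive integers $s$ and $n$ with $s\le n/3$, we have \[ \max\big\{C_2(A_n),C_4(A_n),\dots,C_{2s}(A_n)\big\}>c_n\sqrt{sn} \] for all $A_n\in\{-1,1\}^n$.
   Context: For $A_n=(a_1,\dots,a_n)\in\{-1,1\}^n$ and $2\le r\le n$, the $r$-th order correlation measure of $A_n$ is \[ C_r(A_n)=\max_{0\le u_1<u_2<\cdots<u_r<n}\;\max_{1\le m\le n-u_r}\left|\sum_{j=1}^m a_{j+u_1}a_{j+u_2}\cdots a_{j+u_r}\right|, \] where $u_1,\dots,u_r$ and $m$ are integers. Here $e$ is Euler's number. *)

theory Defs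
  imports "HOL-Analysis.Analysis"
begin

text \<open>
  A binary sequence of length \<open>n\<close> is a function whose relevant arguments are \<open>1, \<dots>, n\<close>;
  values outside this range are unconstrained, and \<open>correlation\<close> never inspects them.
\<close>

definition binary_seqs :: "nat \<Rightarrow> (nat \<Rightarrow> int) set" where
  "binary_seqs n = {1..n} \<rightarrow> {-1, 1}"

text \<open>The tuples \<open>0 \<le> u\<^sub>1 < \<dots> < u\<^sub>r < n\<close>, as lists; for \<open>r \<ge> 1\<close>, \<open>last u\<close> is \<open>u\<^sub>r\<close>.\<close>

definition shifts :: "nat \<Rightarrow> nat \<Rightarrow> nat list set" where
  "shifts r n = {u. length u = r \<and> sorted_wrt (<) u \<and> set u \<subseteq> {..<n}}"

text \<open>
  Meaningful for \<open>2 \<le> r \<le> n\<close> (already for \<open>1 \<le> r \<le> n\<close>), where both maxima range over finite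
  nonempty sets.
\<close>

definition correlation :: "nat \<Rightarrow> nat \<Rightarrow> (nat \<Rightarrow> int) \<Rightarrow> int" where
  "correlation r n a =
     (MAX u \<in> shifts r n. MAX m \<in> {1..n - last u}. \<bar>\<Sum>j = 1..m. \<Prod>i<r. a (j + u ! i)\<bar>)"

end

theory Submission
  imports Defs
begin

text \<open>
  Products of shifted copies of the sequence are \<open>\<plusminus>1\<close> vectors, and their inner products are
  correlations. Put \<open>m = n div 3\<close>. For a set \<open>U\<close> of \<open>s\<close> shifts in \<open>{0..n - m}\<close> let
  \<open>v\<^sub>U(j) = (\<Prod>u\<in>U. a (j + u))\<close> for \<open>1 \<le> j \<le> m\<close>. In \<open>v\<^sub>U(j) * v\<^sub>V(j)\<close> the factors with
  \<open>u \<in> U \<inter> V\<close> cancel, so for \<open>U \<noteq> V\<close> the inner product of \<open>v\<^sub>U\<close> and \<open>v\<^sub>V\<close> is one of the sums in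
  the definition of the correlation of order \<open>2t\<close>, where \<open>2t = card (U - V) + card (V - U)\<close> lies
  between \<open>2\<close> and \<open>2s\<close>. Hence it is at most \<open>M\<close>, the maximum in the theorem.

  On the other hand there are \<open>K = (n - m + 1 choose s)\<close> such vectors, which is more than the
  number \<open>D = (m + s - 1 choose s)\<close> of monomials of degree \<open>s\<close> in \<open>m\<close> variables. Their tensor powers
  of degree \<open>s\<close> lie in a space of dimension \<open>D\<close> and cannot be almost orthogonal: this is Welch's
  inequality, lemma \<open>welch_inequality_signs\<close>. Comparing the two facts gives
  \<open>M ^ (2s) \<ge> m ^ (2s) * (1 / D - 1 / K)\<close>, lemma \<open>correlation_power_lower_bound\<close>.

  The remaining estimates are \<open>D \<le> (2m) ^ s / s!\<close>, where \<open>s \<le> m\<close> enters, \<open>D / K \<le> exp (- 1/2)\<close>, and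
  \<open>s! \<ge> e * (s / e) ^ s\<close>. The spare factor \<open>e\<close> in the last one outweighs \<open>1 - D / K\<close>, because
  \<open>e * (1 - exp (- 1/2)) > 1\<close>. So \<open>M\<^sup>2 > m * s / (2 * e)\<close>, uniformly in \<open>s\<close>, and
  \<open>c n = sqrt ((n div 3) / (2 * e * n))\<close> is a valid choice.
\<close>

section \<open>Welch's inequality for sign vectors\<close>

lemma prod_over_fibres:
  fixes f :: "'a \<Rightarrow> 'b :: comm_monoid_mult"
  assumes "finite I" "finite A" "J ` I \<subseteq> A"
  shows "(\<Prod>i\<in>I. f (J i)) = (\<Prod>y\<in>A. f y ^ card {i \<in> I. J i = y})"
proof -
  have "(\<Prod>i\<in>I. f (J i)) = (\<Prod>y\<in>A. \<Prod>i\<in>{i \<in> I. J i = y}. f (J i))"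
    using prod.group[OF assms, of "\<lambda>i. f (J i)"] by simp
  also have "\<dots> = (\<Prod>y\<in>A. f y ^ card {i \<in> I. J i = y})"
    by (intro prod.cong refl) simp
  finally show ?thesis .
qed

text \<open>
  Collisions are fewest when all classes have the same size; this is the Cauchy-Schwarz inequality
  for the class sizes.
\<close>

lemma card_collisions_lower_bound:
  assumes "finite T" "finite C" "h ` T \<subseteq> C"
  shows "real (card T) ^ 2 \<le> real (card C) * real (card {(x, y) \<in> T \<times> T. h x = h y})"
proof -
  let ?N = "\<lambda>c. card {x \<in> T. h x = c}"
  have "card T = (\<Sum>c\<in>C. ?N c)"
    using sum.group[OF assms, of "\<lambda>_. 1::nat"] by simp
  then have T: "real (card T) = (\<Sum>c\<in>C. real (?N c))" by simp
  have "{(x, y) \<in> T \<times> T. h x = h y} = (\<Union>c\<in>C. {x \<in> T. h x = c} \<times> {x \<in> T. h x = c})"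
    using assms(3) by auto
  then have "card {(x, y) \<in> T \<times> T. h x = h y} =
      card (\<Union>c\<in>C. {x \<in> T. h x = c} \<times> {x \<in> T. h x = c})"
    by (rule arg_cong)
  also have "\<dots> = (\<Sum>c\<in>C. card ({x \<in> T. h x = c} \<times> {x \<in> T. h x = c}))"
    by (rule card_UN_disjoint) (use assms in auto)
  also have "\<dots> = (\<Sum>c\<in>C. ?N c ^ 2)"
    by (simp add: card_cartesian_product power2_eq_square)
  finally have P: "real (card {(x, y) \<in> T \<times> T. h x = h y}) = (\<Sum>c\<in>C. real (?N c) ^ 2)"
    by simp
  show ?thesis
    unfolding T P using sum_squared_le_sum_of_squares[of "\<lambda>c. real (?N c)" C]
    by (simp add: mult.commute)
qed

text \<open>
  Expanding the \<open>2k\<close>-th powers writes the left-hand side as the sum, over all pairs of words of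
  length \<open>k\<close> in \<open>A\<close>, of the square of \<open>\<Sum>x\<in>X\<close> of the product of the two corresponding monomials in
  the coordinates of \<open>v x\<close>. Two words which are permutations of each other give the same monomial,
  so such a pair contributes \<open>(card X)\<^sup>2\<close>; all other pairs contribute at least \<open>0\<close>. The words fall
  into as many permutation classes as there are multisets of size \<open>k\<close> in \<open>A\<close>, so there are many
  pairs of the first kind.
\<close>

lemma welch_inequality_signs:
  fixes v :: "'x \<Rightarrow> 'a \<Rightarrow> real"
  assumes X: "finite X" and A: "finite A"
    and sgn: "\<And>x y. x \<in> X \<Longrightarrow> y \<in> A \<Longrightarrow> v x y ^ 2 = 1"
  shows "real (card X) ^ 2 * real (card A) ^ (2 * k) \<le>
    real (k + card A - 1 choose k) * (\<Sum>x\<in>X. \<Sum>y\<in>X. (\<Sum>j\<in>A. v x j * v y j) ^ (2 * k))"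
proof -
  define T where "T = PiE {..<k} (\<lambda>_. A)"
  define F where "F J x = (\<Prod>i<k. v x (J i))" for J x
  obtain as where as: "set as = A" "distinct as" using finite_distinct_list[OF A] by blast
  \<comment> \<open>The multiset of the letters of a word, recorded by its multiplicities.\<close>
  define h where "h J = map (\<lambda>y. card {i \<in> {..<k}. J i = y}) as" for J :: "nat \<Rightarrow> 'a"
  define C where "C = {l :: nat list. length l = card A \<and> sum_list l = k}"
  define S where "S = (\<Sum>x\<in>X. \<Sum>y\<in>X. (\<Sum>j\<in>A. v x j * v y j) ^ (2 * k))"
  have T: "finite T" "card T = card A ^ k"
    using A by (auto simp: T_def finite_PiE card_PiE)
  have "finite C"
  proof (rule finite_subset)
    show "C \<subseteq> {l. set l \<subseteq> {..k} \<and> length l = card A}"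
      using member_le_sum_list by (auto simp: C_def)
  qed (simp add: finite_lists_length_eq)
  have cC: "card C = (k + card A - 1 choose k)"
    unfolding C_def by (rule card_length_sum_list)
  have "h J \<in> C" if "J \<in> T" for J
  proof -
    have "J ` {..<k} \<subseteq> A" using that by (auto simp: T_def)
    then have "(\<Sum>y\<in>A. card {i \<in> {..<k}. J i = y}) = k"
      using sum.group[of "{..<k}" A J "\<lambda>_. 1::nat"] A by simp
    then show ?thesis
      using as by (simp add: C_def h_def sum_list_distinct_conv_sum_set distinct_card[symmetric])
  qed
  then have hC: "h ` T \<subseteq> C" by auto
  have same: "F J x * F J' x = 1" if J: "J \<in> T" "J' \<in> T" "h J = h J'" and x: "x \<in> X" for J J' x
  proof -
    have *: "F L x = (\<Prod>y\<in>A. v x y ^ card {i \<in> {..<k}. L i = y})" if "L \<in> T" for L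
      unfolding F_def by (rule prod_over_fibres) (use that A in \<open>auto simp: T_def\<close>)
    have "card {i \<in> {..<k}. J i = y} = card {i \<in> {..<k}. J' i = y}" if "y \<in> A" for y
      using J(3) that as by (auto simp: h_def)
    then have "F J' x = F J x"
      using J by (simp add: * cong: prod.cong)
    moreover have "F J x ^ 2 = 1"
      using J(1) x sgn unfolding F_def prod_power_distrib
      by (intro prod.neutral) (auto simp: T_def)
    ultimately show ?thesis by (simp add: power2_eq_square)
  qed
  have expand: "(\<Sum>j\<in>A. v x j * v y j) ^ (2 * k) =
      (\<Sum>J\<in>T. \<Sum>J'\<in>T. (F J x * F J' x) * (F J y * F J' y))" for x y
  proof -
    have "(\<Sum>j\<in>A. v x j * v y j) ^ k = (\<Prod>i<k. \<Sum>j\<in>A. v x j * v y j)" by simp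
    also have "\<dots> = (\<Sum>J\<in>T. F J x * F J y)"
      unfolding T_def F_def using A by (subst prod_sum_PiE) (auto simp: prod.distrib)
    finally have "(\<Sum>j\<in>A. v x j * v y j) ^ (2 * k) = (\<Sum>J\<in>T. F J x * F J y) ^ 2"
      by (metis mult.commute power_mult)
    then show ?thesis
      by (simp add: power2_eq_square sum_product mult_ac)
  qed
  have "S = (\<Sum>x\<in>X. \<Sum>y\<in>X. \<Sum>p\<in>T \<times> T.
      (F (fst p) x * F (snd p) x) * (F (fst p) y * F (snd p) y))"
    unfolding S_def expand by (simp add: sum.cartesian_product case_prod_beta)
  also have "\<dots> = (\<Sum>x\<in>X. \<Sum>p\<in>T \<times> T. \<Sum>y\<in>X.
      (F (fst p) x * F (snd p) x) * (F (fst p) y * F (snd p) y))"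
    by (intro sum.cong refl sum.swap)
  also have "\<dots> = (\<Sum>p\<in>T \<times> T. \<Sum>x\<in>X. \<Sum>y\<in>X.
      (F (fst p) x * F (snd p) x) * (F (fst p) y * F (snd p) y))"
    by (rule sum.swap)
  also have "\<dots> = (\<Sum>p\<in>T \<times> T. (\<Sum>x\<in>X. F (fst p) x * F (snd p) x) ^ 2)"
    by (simp add: power2_eq_square sum_product)
  finally have S: "S = (\<Sum>p\<in>T \<times> T. (\<Sum>x\<in>X. F (fst p) x * F (snd p) x) ^ 2)" .
  let ?P = "{(J, J') \<in> T \<times> T. h J = h J'}"
  have "real (card ?P) * real (card X) ^ 2 =
      (\<Sum>p\<in>?P. (\<Sum>x\<in>X. F (fst p) x * F (snd p) x) ^ 2)"
    using same by (auto simp: case_prod_beta)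
  also have "\<dots> \<le> S"
    unfolding S by (rule sum_mono2) (use T in auto)
  finally have PS: "real (card ?P) * real (card X) ^ 2 \<le> S" .
  have "real (card X) ^ 2 * real (card A) ^ (2 * k) = real (card X) ^ 2 * real (card T) ^ 2"
    by (simp add: T mult.commute flip: power_mult)
  also have "\<dots> \<le> real (card X) ^ 2 * (real (card C) * real (card ?P))"
    by (intro mult_left_mono card_collisions_lower_bound T \<open>finite C\<close> hC) simp
  also have "\<dots> = real (card C) * (real (card ?P) * real (card X) ^ 2)" by simp
  also have "\<dots> \<le> real (card C) * S" by (intro mult_left_mono PS) simp
  finally show ?thesis by (simp add: cC S_def)
qed

section \<open>Inner products of shift products are correlations\<close>

lemma finite_shifts: "finite (shifts r n)"
  by (rule finite_subset[OF _ finite_lists_length_eq[of "{..<n}" r]]) (auto simp: shifts_def)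

lemma correlation_ge:
  assumes W: "W \<subseteq> {..n - m}" "W \<noteq> {}" and m: "1 \<le> m" "m \<le> n"
  shows "\<bar>\<Sum>j = 1..m. \<Prod>w\<in>W. a (j + w)\<bar> \<le> correlation (card W) n a"
proof -
  have fW: "finite W" using W(1) finite_subset by blast
  define u where "u = sorted_list_of_set W"
  have u: "set u = W" "distinct u" "length u = card W" "sorted_wrt (<) u"
    using fW by (auto simp: u_def)
  have "u \<noteq> []" using u W by auto
  then have "last u \<in> W" using u last_in_set by blast
  then have mu: "m \<in> {1..n - last u}" using W m by auto
  have "W \<subseteq> {..<n}" using W(1) m by auto
  then have us: "u \<in> shifts (card W) n" using u by (simp add: shifts_def)
  have "bij_betw ((!) u) {..<card W} W" by (rule bij_betw_nth) (simp_all add: u)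
  note prod.reindex_bij_betw[OF this]
  then have "(\<Prod>i<card W. a (j + u ! i)) = (\<Prod>w\<in>W. a (j + w))" for j .
  then have "\<bar>\<Sum>j = 1..m. \<Prod>w\<in>W. a (j + w)\<bar> = \<bar>\<Sum>j = 1..m. \<Prod>i<card W. a (j + u ! i)\<bar>"
    by simp
  also have "\<dots> \<le> (MAX m \<in> {1..n - last u}. \<bar>\<Sum>j = 1..m. \<Prod>i<card W. a (j + u ! i)\<bar>)"
    by (rule Max_ge) (use mu in auto)
  also have "\<dots> \<le> correlation (card W) n a"
    unfolding correlation_def by (rule Max_ge) (use us finite_shifts in auto)
  finally show ?thesis .
qed

lemma prod_mult_prod_symmetric_difference:
  fixes f :: "'a \<Rightarrow> 'b :: comm_ring_1"
  assumes "finite U" "finite V" and sq: "\<And>x. x \<in> U \<inter> V \<Longrightarrow> f x * f x = 1"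
  shows "prod f U * prod f V = prod f ((U - V) \<union> (V - U))"
proof -
  have U: "prod f U = prod f (U \<inter> V) * prod f (U - V)"
    using prod.Int_Diff[of U f V] assms by simp
  have V: "prod f V = prod f (U \<inter> V) * prod f (V - U)"
    using prod.Int_Diff[of V f U] assms by (simp add: Int_commute)
  have one: "prod f (U \<inter> V) * prod f (U \<inter> V) = 1"
    using sq by (simp flip: prod.distrib)
  have "prod f U * prod f V =
      (prod f (U \<inter> V) * prod f (U \<inter> V)) * (prod f (U - V) * prod f (V - U))"
    unfolding U V by (simp only: mult_ac)
  also have "\<dots> = prod f (U - V) * prod f (V - U)" unfolding one by simp
  also have "\<dots> = prod f ((U - V) \<union> (V - U))"
    using assms by (intro prod.union_disjoint[symmetric]) auto
  finally show ?thesis .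
qed

lemma binary_seqs_square:
  assumes "a \<in> binary_seqs n" "m \<le> n" "j \<in> {1..m}" "u \<le> n - m"
  shows "a (j + u) ^ 2 = 1"
proof -
  have "j + u \<in> {1..n}" using assms by auto
  then have "a (j + u) \<in> {-1, 1}" using assms(1) by (auto simp: binary_seqs_def)
  then show ?thesis by auto
qed

lemma inner_product_le_max_correlation:
  assumes a: "a \<in> binary_seqs n" and m: "1 \<le> m" "m \<le> n"
    and U: "U \<subseteq> {..n - m}" "card U = s" and V: "V \<subseteq> {..n - m}" "card V = s" and "U \<noteq> V"
  shows "\<bar>\<Sum>j = 1..m. (\<Prod>u\<in>U. a (j + u)) * (\<Prod>u\<in>V. a (j + u))\<bar> \<le>
    (MAX t \<in> {1..s}. correlation (2 * t) n a)"
proof -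
  define W where "W = (U - V) \<union> (V - U)"
  have fin: "finite U" "finite V" using U V finite_subset by blast+
  have "card (U - V) = s - card (U \<inter> V)" "card (V - U) = s - card (U \<inter> V)"
    using U V fin by (auto simp: card_Diff_subset_Int Int_commute)
  moreover have "card W = card (U - V) + card (V - U)"
    unfolding W_def using fin by (intro card_Un_disjoint) auto
  ultimately have cW: "card W = 2 * (s - card (U \<inter> V))" by simp
  have "W \<noteq> {}" using \<open>U \<noteq> V\<close> by (auto simp: W_def)
  moreover have "finite W" using fin by (simp add: W_def)
  ultimately have "card W > 0" by (simp add: card_gt_0_iff)
  then have t: "s - card (U \<inter> V) \<in> {1..s}" using cW by auto
  have "(\<Prod>u\<in>U. a (j + u)) * (\<Prod>u\<in>V. a (j + u)) = (\<Prod>w\<in>W. a (j + w))"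
    if j: "j \<in> {1..m}" for j
    unfolding W_def
  proof (rule prod_mult_prod_symmetric_difference[OF fin])
    fix u assume "u \<in> U \<inter> V"
    then have "u \<le> n - m" using U(1) by auto
    then show "a (j + u) * a (j + u) = 1"
      using binary_seqs_square[OF a m(2) j] by (simp add: power2_eq_square)
  qed
  then have "\<bar>\<Sum>j = 1..m. (\<Prod>u\<in>U. a (j + u)) * (\<Prod>u\<in>V. a (j + u))\<bar> =
      \<bar>\<Sum>j = 1..m. \<Prod>w\<in>W. a (j + w)\<bar>"
    by (intro arg_cong[where f = abs] sum.cong refl)
  also have "\<dots> \<le> correlation (card W) n a"
    by (rule correlation_ge[OF _ \<open>W \<noteq> {}\<close> m]) (use U(1) V(1) in \<open>auto simp: W_def\<close>)
  also have "\<dots> \<le> (MAX t \<in> {1..s}. correlation (2 * t) n a)"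
    unfolding cW by (intro Max_ge imageI t finite_imageI finite_atLeastAtMost)
  finally show ?thesis .
qed

text \<open>
  Welch's inequality, applied to the \<open>K = (n - m + 1 choose s)\<close> shift products: the \<open>K\<close> diagonal
  terms equal \<open>m ^ (2 * s)\<close> and the others are at most \<open>M ^ (2 * s)\<close>. The diagonal terms are
  responsible for the \<open>1 / K\<close> in \<open>M ^ (2 * s) \<ge> m ^ (2 * s) * (1 / D - 1 / K)\<close>, which is stated here
  without denominators.
\<close>

lemma correlation_power_lower_bound:
  fixes a :: "nat \<Rightarrow> int"
  assumes a: "a \<in> binary_seqs n" and m: "1 \<le> m" "m \<le> n" and s: "s \<le> n - m + 1"
  defines "M \<equiv> real_of_int (MAX t \<in> {1..s}. correlation (2 * t) n a)"
    and "K \<equiv> real (n - m + 1 choose s)" and "D \<equiv> real (m + s - 1 choose s)"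
  shows "real m ^ (2 * s) * (K - D) \<le> D * K * M ^ (2 * s)"
proof -
  define X where "X = {U. U \<subseteq> {..n - m} \<and> card U = s}"
  define v where "v U j = real_of_int (\<Prod>u\<in>U. a (j + u))" for U j
  have X: "finite X" "real (card X) = K"
    using n_subsets[of "{..n - m}" s] by (auto simp: X_def K_def)
  have K: "K > 0" using s by (simp add: K_def)
  have D: "D \<ge> 0" by (simp add: D_def)
  have sgn: "v U j ^ 2 = 1" if "U \<in> X" "j \<in> {1..m}" for U j
  proof -
    have "a (j + u) ^ 2 = 1" if "u \<in> U" for u
      using binary_seqs_square[OF a m(2) \<open>j \<in> {1..m}\<close>, of u] that \<open>U \<in> X\<close> by (auto simp: X_def)
    then have "(\<Prod>u\<in>U. a (j + u)) ^ 2 = 1"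
      unfolding prod_power_distrib by (intro prod.neutral) auto
    then show ?thesis unfolding v_def by (metis of_int_1 of_int_power)
  qed
  have off: "(\<Sum>j\<in>{1..m}. v U j * v V j) ^ (2 * s) \<le> M ^ (2 * s)"
    if "U \<in> X" "V \<in> X" "U \<noteq> V" for U V
  proof -
    have "\<bar>\<Sum>j\<in>{1..m}. v U j * v V j\<bar> =
        real_of_int \<bar>\<Sum>j = 1..m. (\<Prod>u\<in>U. a (j + u)) * (\<Prod>u\<in>V. a (j + u))\<bar>"
      by (simp add: v_def)
    also have "\<dots> \<le> M"
      unfolding M_def of_int_le_iff
      using that a m by (intro inner_product_le_max_correlation) (auto simp: X_def)
    finally have "\<bar>\<Sum>j\<in>{1..m}. v U j * v V j\<bar> ^ (2 * s) \<le> M ^ (2 * s)"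
      by (intro power_mono) auto
    then show ?thesis by (simp add: power_even_abs)
  qed
  have diag: "(\<Sum>j\<in>{1..m}. v U j * v U j) = real m" if "U \<in> X" for U
    using sgn[OF that] by (simp add: power2_eq_square)
  have pos: "M ^ (2 * s) \<ge> 0" by simp
  have "K ^ 2 * real m ^ (2 * s) \<le>
      D * (\<Sum>U\<in>X. \<Sum>V\<in>X. (\<Sum>j\<in>{1..m}. v U j * v V j) ^ (2 * s))"
    using welch_inequality_signs[OF X(1) _ sgn, where A = "{1..m}" and k = s] X(2)
    by (simp add: D_def add.commute)
  also have "\<dots> \<le> D * (\<Sum>U\<in>X. \<Sum>V\<in>X. (if U = V then real m ^ (2 * s) else 0) + M ^ (2 * s))"
    using off diag pos by (intro mult_left_mono[OF _ D] sum_mono) auto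
  also have "\<dots> = D * (K * real m ^ (2 * s) + K ^ 2 * M ^ (2 * s))"
    using X by (simp add: sum.distrib sum.delta power2_eq_square distrib_left)
  finally have "K * (real m ^ (2 * s) * (K - D)) \<le> K * (D * K * M ^ (2 * s))"
    by (simp add: algebra_simps power2_eq_square)
  then show ?thesis using K by simp
qed

section \<open>Numerical estimates\<close>

lemma fact_lower_bound:
  assumes "s \<ge> 1"
  shows "exp 1 * (real s / exp 1) ^ s \<le> fact s"
  using assms
proof (induction s rule: dec_induct)
  case base
  then show ?case by simp
next
  case (step s)
  have s: "real s > 0" using step by simp
  \<comment> \<open>The step from \<open>s\<close> to \<open>s + 1\<close> is the inequality \<open>(1 + 1 / s) ^ s \<le> e\<close>.\<close>
  have "(1 + 1 / real s) ^ s \<le> exp (1 / real s) ^ s"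
    by (intro power_mono) auto
  also have "\<dots> = exp 1" using s by (simp flip: exp_of_nat_mult)
  finally have "(real s * (1 + 1 / real s)) ^ s \<le> real s ^ s * exp 1"
    unfolding power_mult_distrib by (intro mult_left_mono) auto
  then have *: "real (Suc s) ^ s \<le> real s ^ s * exp 1"
    using s by (simp add: distrib_left add.commute)
  have "exp 1 * (real (Suc s) / exp 1) ^ Suc s = real (Suc s) * (real (Suc s) ^ s / exp 1 ^ s)"
    by (simp add: power_divide)
  also have "\<dots> \<le> real (Suc s) * (real s ^ s * exp 1 / exp 1 ^ s)"
    using * by (intro mult_left_mono divide_right_mono) auto
  also have "\<dots> = real (Suc s) * (exp 1 * (real s / exp 1) ^ s)"
    by (simp add: power_divide)
  also have "\<dots> \<le> real (Suc s) * fact s"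
    using step by (intro mult_left_mono) auto
  finally show ?case by simp
qed

lemma binomial_le_ratio_power:
  assumes "s \<le> p" "p \<le> N" "N > 0"
  shows "real (p choose s) \<le> (real p / real N) ^ s * real (N choose s)"
proof -
  have "real (p choose s) = (\<Prod>i = 0..<s. real (p - i) / real (s - i))"
    using assms by (intro binomial_altdef_of_nat) auto
  also have "\<dots> \<le> (\<Prod>i = 0..<s. real p / real N * (real (N - i) / real (s - i)))"
  proof (intro prod_mono conjI)
    fix i assume i: "i \<in> {0..<s}"
    have "real i * real p \<le> real i * real N" using assms by (intro mult_left_mono) auto
    then have "real (p - i) \<le> real p / real N * real (N - i)"
      using i assms by (simp add: of_nat_diff field_simps)
    then show "real (p - i) / real (s - i) \<le> real p / real N * (real (N - i) / real (s - i))"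
      unfolding times_divide_eq_right by (rule divide_right_mono) simp
  qed auto
  also have "\<dots> = (real p / real N) ^ s * (\<Prod>i = 0..<s. real (N - i) / real (s - i))"
    unfolding prod.distrib by simp
  also have "(\<Prod>i = 0..<s. real (N - i) / real (s - i)) = real (N choose s)"
    using assms by (intro binomial_altdef_of_nat[symmetric]) auto
  finally show ?thesis .
qed

text \<open>
  The ratio is at most \<open>(1 - (m + 2 - s) / (2 * m + 1)) ^ s\<close>, hence at most
  \<open>exp (- s * (m + 2 - s) / (2 * m + 1))\<close>. The exponent is concave in \<open>s\<close> up to sign, so its size is
  smallest at the ends \<open>s = 1\<close> and \<open>s = m\<close>, where it exceeds \<open>1/2\<close>.
\<close>

lemma binomial_ratio_le:
  assumes s: "1 \<le> s" "s \<le> m" and N: "2 * m + 1 \<le> N"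
  shows "real (m + s - 1 choose s) \<le> exp (- 1 / 2) * real (N choose s)"
proof -
  define x where "x = (real m + 2 - real s) / (2 * real m + 1)"
  have "real (m + s - 1) / real N \<le> real (m + s - 1) / (2 * real m + 1)"
    using N by (intro divide_left_mono) auto
  also have "\<dots> = 1 - x" using s by (simp add: x_def of_nat_diff field_simps)
  also have "\<dots> \<le> exp (- x)" using exp_ge_add_one_self[of "- x"] by simp
  finally have "(real (m + s - 1) / real N) ^ s \<le> exp (- x) ^ s"
    by (intro power_mono) auto
  also have "\<dots> = exp (- (real s * x))" by (simp flip: exp_of_nat_mult)
  also have "\<dots> \<le> exp (- 1 / 2)"
  proof -
    \<comment> \<open>The concave function \<open>s * (m + 2 - s)\<close> equals \<open>m + 1\<close> at \<open>s = 1\<close> and at \<open>s = m + 1\<close>.\<close>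
    have "(real s - 1) * (real m + 1 - real s) \<ge> 0" using s by (intro mult_nonneg_nonneg) auto
    then have "real s * (real m + 2 - real s) \<ge> real m + 1" by (simp add: algebra_simps)
    then have "real s * x \<ge> 1 / 2" by (simp add: x_def field_simps)
    then show ?thesis by simp
  qed
  finally have "(real (m + s - 1) / real N) ^ s \<le> exp (- 1 / 2)" .
  then have "(real (m + s - 1) / real N) ^ s * real (N choose s) \<le> exp (- 1 / 2) * real (N choose s)"
    by (intro mult_right_mono) auto
  moreover have "real (m + s - 1 choose s) \<le> (real (m + s - 1) / real N) ^ s * real (N choose s)"
    using s N by (intro binomial_le_ratio_power) auto
  ultimately show ?thesis by linarith
qed

text \<open>This is where \<open>e\<close>, gained from \<open>s!\<close>, pays for \<open>1 - D / K\<close>; the actual value is about \<open>1.07\<close>.\<close>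

lemma exp_1_mult_one_minus_exp_gt_1: "exp 1 * (1 - exp (- 1 / 2)) > (1 :: real)"
proof -
  define x :: real where "x = exp (1 / 2)"
  have x: "x \<ge> 13 / 8"
    using exp_lower_Taylor_quadratic[of "1 / 2"] by (simp add: x_def power2_eq_square)
  have "exp 1 = x * x" by (simp add: x_def flip: exp_add)
  moreover have "exp (- 1 / 2) = 1 / x" by (simp add: x_def exp_minus inverse_eq_divide)
  ultimately have "exp 1 * (1 - exp (- 1 / 2)) = x * (x - 1)"
    using x by (simp add: field_simps)
  also have "\<dots> \<ge> 13 / 8 * (13 / 8 - 1)" using x by (intro mult_mono) auto
  finally show ?thesis by simp
qed

section \<open>The lower bound\<close>

text \<open>
  A window of length \<open>m \<le> n / 3\<close> leaves \<open>n - m + 1 \<ge> 2 * m + 1\<close> admissible shifts. This makes the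
  vectors outnumber the monomials; the larger \<open>m\<close>, the better the bound. What is compared in the end
  are \<open>s\<close>-th powers, so any factor at least \<open>1\<close> left over from \<open>s!\<close> may be dropped before the root
  is taken, which makes the bound uniform in \<open>s\<close>.
\<close>

lemma max_correlation_square_gt:
  fixes a :: "nat \<Rightarrow> int"
  assumes a: "a \<in> binary_seqs n" and s: "1 \<le> s" "s \<le> m" and n: "3 * m \<le> n"
  defines "M \<equiv> real_of_int (MAX t \<in> {1..s}. correlation (2 * t) n a)"
  shows "M ^ 2 > real m * real s / (2 * exp 1)"
proof -
  define K where "K = real (n - m + 1 choose s)"
  define D where "D = real (m + s - 1 choose s)"
  define q where "q = 1 - exp (- 1 / 2 :: real)"
  have K: "K > 0" using s n by (simp add: K_def)
  have D: "D > 0" using s by (simp add: D_def)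
  have q: "q > 0" by (simp add: q_def)
  have m: "real m > 0" using s by simp
  have "D \<le> exp (- 1 / 2) * K"
    unfolding D_def K_def using s n by (intro binomial_ratio_le) auto
  then have KD: "q * K \<le> K - D" by (simp add: q_def algebra_simps)
  have "real m ^ (2 * s) * (q * K) \<le> real m ^ (2 * s) * (K - D)"
    by (intro mult_left_mono KD) auto
  also have "\<dots> \<le> D * K * M ^ (2 * s)"
    unfolding D_def K_def M_def using a s n by (intro correlation_power_lower_bound) auto
  finally have "K * (real m ^ (2 * s) * q) \<le> K * (D * M ^ (2 * s))" by (simp add: mult_ac)
  then have main: "real m ^ (2 * s) * q \<le> D * M ^ (2 * s)" using K by simp
  have "(m + s - 1 choose s) * fact s \<le> (m + s - 1) ^ s" by (rule binomial_fact_pow)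
  also have "\<dots> \<le> (2 * m) ^ s" using s by (intro power_mono) auto
  finally have "real ((m + s - 1 choose s) * fact s) \<le> real ((2 * m) ^ s)"
    by (simp only: of_nat_le_iff)
  then have Dfact: "D * fact s \<le> (2 * real m) ^ s" by (simp add: D_def)
  have "(real s / exp 1) ^ s * 1 < (real s / exp 1) ^ s * (exp 1 * q)"
    using s exp_1_mult_one_minus_exp_gt_1 unfolding q_def
    by (intro mult_strict_left_mono zero_less_power) auto
  also have "\<dots> \<le> fact s * q"
    using mult_right_mono[OF fact_lower_bound[OF s(1)], of q] q by (simp add: mult_ac)
  finally have "real m ^ (2 * s) * (real s / exp 1) ^ s < real m ^ (2 * s) * (fact s * q)"
    using m by simp
  also have "\<dots> = fact s * (real m ^ (2 * s) * q)" by simp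
  also have "\<dots> \<le> fact s * (D * M ^ (2 * s))"
    by (intro mult_left_mono main) auto
  also have "\<dots> = D * fact s * M ^ (2 * s)" by simp
  also have "\<dots> \<le> (2 * real m) ^ s * M ^ (2 * s)"
    by (intro mult_right_mono Dfact) auto
  finally have "(real m ^ 2 * (real s / exp 1)) ^ s < (2 * real m * M ^ 2) ^ s"
    by (simp only: power_mult power_mult_distrib)
  then have "real m ^ 2 * (real s / exp 1) < 2 * real m * M ^ 2"
    by (rule power_less_imp_less_base) (use m in auto)
  then have "2 * real m * (real m * real s / (2 * exp 1)) < 2 * real m * M ^ 2"
    by (simp add: power2_eq_square)
  then show ?thesis by (rule mult_left_less_imp_less) simp
qed

definition correlation_constant :: "nat \<Rightarrow> real" where
  "correlation_constant n = sqrt (real (n div 3) / (2 * exp 1 * real n))"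

text \<open>
  For \<open>n \<ge> 3\<close> the quotient \<open>(n div 3) / n\<close> is smallest at \<open>n = 5\<close>; with the value \<open>1/5\<close> there, the
  crude bound \<open>e \<le> 3\<close> suffices.
\<close>

lemma correlation_constant_gt:
  assumes "n \<ge> 3"
  shows "correlation_constant n > 1 / 9"
proof -
  have "n \<le> 5 * (n div 3)" using assms by presburger
  then have *: "real n \<le> 5 * real (n div 3)" by linarith
  have n: "real n > 0" using assms by simp
  have "2 * exp 1 * real n \<le> 6 * real n" using exp_le n by (intro mult_right_mono) auto
  also have "\<dots> < 81 * real (n div 3)" using * n by linarith
  finally have "(1 / 9) ^ 2 < real (n div 3) / (2 * exp 1 * real n)"
    using n by (simp add: field_simps power2_eq_square)
  then show ?thesis
    unfolding correlation_constant_def by (intro real_less_rsqrt)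
qed

lemma correlation_constant_tendsto:
  "correlation_constant \<longlonglongrightarrow> 1 / sqrt (6 * exp 1)"
proof -
  have third: "(\<lambda>n. real (n div 3) / real n) \<longlonglongrightarrow> 1 / 3"
  proof (rule real_tendsto_sandwich)
    show "\<forall>\<^sub>F n in sequentially. 1 / 3 - 1 / real n \<le> real (n div 3) / real n"
    proof (rule eventually_sequentiallyI[of 1])
      fix n :: nat assume "1 \<le> n"
      then have "1 / 3 - 1 / real n = (real n - 3) / 3 / real n" by (simp add: field_simps)
      moreover have "real n \<le> 3 * real (n div 3) + 3" by linarith
      then have "(real n - 3) / 3 / real n \<le> real (n div 3) / real n"
        by (intro divide_right_mono) auto
      ultimately show "1 / 3 - 1 / real n \<le> real (n div 3) / real n" by simp
    qed
    show "\<forall>\<^sub>F n in sequentially. real (n div 3) / real n \<le> 1 / 3"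
    proof (rule eventually_sequentiallyI[of 1])
      fix n :: nat assume "1 \<le> n"
      moreover have "3 * real (n div 3) \<le> real n" by linarith
      ultimately show "real (n div 3) / real n \<le> 1 / 3" by (simp add: field_simps)
    qed
    show "(\<lambda>n. 1 / 3 - 1 / real n) \<longlonglongrightarrow> 1 / 3"
      using tendsto_diff[OF tendsto_const lim_1_over_n, of "1 / 3 :: real"] by simp
  qed simp
  have "(\<lambda>n. sqrt (real (n div 3) / real n / (2 * exp 1))) \<longlonglongrightarrow> sqrt (1 / 3 / (2 * exp 1))"
    by (intro tendsto_intros third) auto
  then show ?thesis
    by (simp add: correlation_constant_def[abs_def] real_sqrt_divide mult_ac real_sqrt_mult)
qed

theorem theorem1p3:
  shows "\<exists>c :: nat \<Rightarrow> real.
    (\<forall>k\<ge>3. c k > 1 / 9) \<and>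
    c \<longlonglongrightarrow> 1 / sqrt (6 * exp 1) \<and>
    (\<forall>s n :: nat. s > 0 \<longrightarrow> n > 0 \<longrightarrow> real s \<le> real n / 3 \<longrightarrow>
      (\<forall>a \<in> binary_seqs n.
        real_of_int (MAX t \<in> {1..s}. correlation (2 * t) n a) > c n * sqrt (real s * real n)))"
proof (intro exI[of _ correlation_constant] conjI allI impI ballI)
  show "correlation_constant k > 1 / 9" if "k \<ge> 3" for k
    by (rule correlation_constant_gt[OF that])
  show "correlation_constant \<longlonglongrightarrow> 1 / sqrt (6 * exp 1)"
    by (rule correlation_constant_tendsto)
  fix s n :: nat and a :: "nat \<Rightarrow> int"
  assume s: "s > 0" and n: "n > 0" and sn: "real s \<le> real n / 3" and a: "a \<in> binary_seqs n"
  define M where "M = (MAX t \<in> {1..s}. correlation (2 * t) n a)"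
  have "3 * s \<le> n" using sn by linarith
  then have sm: "1 \<le> s" "s \<le> n div 3" using s by auto
  have "1 \<le> n div 3" "n div 3 \<le> n" using sm by auto
  \<comment> \<open>The pair of shifts \<open>{0, 1}\<close> already shows that the maximum is nonnegative.\<close>
  then have "\<bar>\<Sum>j = 1..n div 3. \<Prod>w\<in>{0, 1}. a (j + w)\<bar> \<le> correlation (card {0, 1::nat}) n a"
    by (intro correlation_ge) auto
  then have "0 \<le> correlation (2 * 1) n a" by (simp add: numeral_2_eq_2)
  also have "\<dots> \<le> M" unfolding M_def by (intro Max_ge imageI) (use sm in auto)
  finally have M: "real_of_int M \<ge> 0" by simp
  have "correlation_constant n * sqrt (real s * real n) =
      sqrt (real (n div 3) * real s / (2 * exp 1))"
    using n by (simp add: correlation_constant_def flip: real_sqrt_mult)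
  also have "\<dots> < sqrt (real_of_int M ^ 2)"
    unfolding M_def by (intro real_sqrt_less_mono max_correlation_square_gt[OF a sm]) simp
  also have "\<dots> = real_of_int M" using M by simp
  finally show "correlation_constant n * sqrt (real s * real n) < real_of_int M" .
qed

end
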